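(* Let $(X,\|\cdot\|)$ be a real normed space, $n\ge2$, $p\in(1,\infty)$, and let $\Omega_1,\ldots,\Omega_n\subset X$ be nonempty closed convex sets. Let $\mathrm{Sol}$ be the set of all global minimisers over $X$ of $$f(x):=\left(d(x,\Omega_1)^p+\cdots+d(x,\Omega_n)^p\right)^{1/p},\quad x\in X,$$ and let $\bar x\in X$ with $\bar x\notin\bigcup_{i=1}^n\Omega_i$. Then the following assertions hold. (i) $\bar x\in\mathrm{Sol}$ if and only if there exist $x_1^*,\ldots,x_n^*\in X^*$ such that $$x_i^*\in\partial d(\cdot,\Omega_i)(\bar x)\ (i=1,\ldots,n)\quad\text{and}\quad\sum_{i=1}^nd(\bar x,\Omega_i)^{p-1}x_i^*=0.\qquad(\ast)$$ (ii) Let $x_1^*,\ldots,x_n^*\in X^*$ satisfy $(\ast)$. Then $\mathrm{Sol}=\bigcap_{i=1}^n\mathbf{D}(\Omega_i,x_i^* )$, where $\mathbf{D}(\Omega_i,x_i^* ):=\mathbf{A}(\Omega_i,x_i^* )\cap\mathbf{E}(\Omega_i,\bar x)$ with $$\mathbf{A}(\Omega_i,x_i^* ):=\{x\in X\mid x_i^*\in\partial d(\cdot,\Omega_i)(x)\},\qquad \mathbf{E}(\Omega_i,\bar x):=\left\{x\in X\;\Big|\;\frac{d(x,\Omega_i)^p}{\sum_{j=1}^nd(x,\Omega_j)^p}=\frac{d(\bar x,\Omega_i)^p}{\sum_{j=1}^nd(\bar x,\Omega_j)^p}\right\}.$$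
   Context: $X^*$ is the topological dual of $X$ with pairing $\langle\cdot,\cdot\rangle$. $d(x,\Omega):=\inf_{u\in\Omega}\|x-u\|$. For a convex function $g:X\to\mathbb{R}$, $\partial g(\bar x):=\{x^*\in X^*\mid\langle x^*,x-\bar x\rangle\le g(x)-g(\bar x)\ \text{for all } x\in X\}$. *)

theory Defs
  imports "HOL-Analysis.Analysis"
begin

text \<open>
  The dual space of a real normed space \<open>'a\<close> is the type \<open>'a \<Rightarrow>\<^sub>L real\<close> of bounded linear functionals.
  The distance \<open>d(x, S)\<close> is \<open>infdist x S\<close>, which is the infimum of \<open>dist x u = norm (x - u)\<close> over
  \<open>u \<in> S\<close> whenever \<open>S\<close> is nonempty. The sets are indexed by \<open>{1..n}\<close>; values of the families
  outside that range are irrelevant.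
\<close>

definition subdiff :: "('a::real_normed_vector \<Rightarrow> real) \<Rightarrow> 'a \<Rightarrow> ('a \<Rightarrow>\<^sub>L real) set" where
  "subdiff g x = {\<xi>. \<forall>y. blinfun_apply \<xi> (y - x) \<le> g y - g x}"

definition dist_objective ::
    "real \<Rightarrow> nat \<Rightarrow> (nat \<Rightarrow> 'a::real_normed_vector set) \<Rightarrow> 'a \<Rightarrow> real" where
  "dist_objective p n \<Omega> x = (\<Sum>i=1..n. infdist x (\<Omega> i) powr p) powr (1 / p)"

definition Sol :: "real \<Rightarrow> nat \<Rightarrow> (nat \<Rightarrow> 'a::real_normed_vector set) \<Rightarrow> 'a set" where
  "Sol p n \<Omega> = {x. \<forall>y. dist_objective p n \<Omega> x \<le> dist_objective p n \<Omega> y}"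

definition optimality_system ::
    "real \<Rightarrow> nat \<Rightarrow> (nat \<Rightarrow> 'a::real_normed_vector set) \<Rightarrow> 'a \<Rightarrow> (nat \<Rightarrow> 'a \<Rightarrow>\<^sub>L real) \<Rightarrow> bool" where
  "optimality_system p n \<Omega> z \<xi> \<longleftrightarrow>
     (\<forall>i\<in>{1..n}. \<xi> i \<in> subdiff (\<lambda>x. infdist x (\<Omega> i)) z) \<and>
     (\<Sum>i=1..n. (infdist z (\<Omega> i) powr (p - 1)) *\<^sub>R \<xi> i) = 0"

definition A_set :: "'a::real_normed_vector set \<Rightarrow> ('a \<Rightarrow>\<^sub>L real) \<Rightarrow> 'a set" where
  "A_set S \<xi> = {x. \<xi> \<in> subdiff (\<lambda>u. infdist u S) x}"

text \<open>
  If \<open>z\<close> lies in none of the sets, the quotient at \<open>z\<close> is positive, so a point \<open>x\<close> with vanishing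
  denominator, where HOL evaluates the quotient to \<open>0\<close>, is not in \<open>E_set\<close>.
\<close>

definition E_set ::
    "real \<Rightarrow> nat \<Rightarrow> (nat \<Rightarrow> 'a::real_normed_vector set) \<Rightarrow> 'a \<Rightarrow> nat \<Rightarrow> 'a set" where
  "E_set p n \<Omega> z i =
     {x. infdist x (\<Omega> i) powr p / (\<Sum>j=1..n. infdist x (\<Omega> j) powr p)
       = infdist z (\<Omega> i) powr p / (\<Sum>j=1..n. infdist z (\<Omega> j) powr p)}"

definition D_set ::
    "real \<Rightarrow> nat \<Rightarrow> (nat \<Rightarrow> 'a::real_normed_vector set) \<Rightarrow> 'a \<Rightarrow> nat \<Rightarrow> ('a \<Rightarrow>\<^sub>L real) \<Rightarrow> 'a set" where
  "D_set p n \<Omega> z i \<xi> = A_set (\<Omega> i) \<xi> \<inter> E_set p n \<Omega> z i"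

end

theory Submission
  imports Defs
begin

text \<open>
  A minimizer of \<open>\<Sum> d\<^sub>i\<^sup>p\<close> also minimizes the convex function \<open>\<Sum> w\<^sub>i d\<^sub>i\<close> obtained by linearizing
  the power, with \<open>w\<^sub>i = d\<^sub>i(z)\<^sup>p\<^sup>-\<^sup>1\<close>, and the subdifferential sum rule splits the zero functional
  accordingly. Conversely, the tangent inequality for the power and the subgradient inequalities
  add up to global optimality. Strict convexity of the power forces all minimizers to have the
  same distances to the sets; a point whose distances are only proportional to those at \<open>z\<close> still
  satisfies the optimality system, since its weights are a common multiple of the \<open>w\<^sub>i\<close>.
\<close>

section \<open>Convexity of infima and of distance functions\<close>

text \<open>Near-optimal indices at the two endpoints are merged into one index for the convex
  combination. This single condition covers three uses: distances to convex sets, infima over chains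
  of convex functions, and infimal convolutions.\<close>

lemma convex_on_INF_directed:
  fixes F :: "'i \<Rightarrow> 'a::real_vector \<Rightarrow> real"
  assumes "A \<noteq> {}" and "convex S"
    and bdd: "\<And>x. x \<in> S \<Longrightarrow> bdd_below ((\<lambda>a. F a x) ` A)"
    and dir: "\<And>a b x y t. \<lbrakk>a \<in> A; b \<in> A; x \<in> S; y \<in> S; 0 < t; t < 1\<rbrakk>
      \<Longrightarrow> \<exists>c\<in>A. F c ((1 - t) *\<^sub>R x + t *\<^sub>R y) \<le> (1 - t) * F a x + t * F b y"
  shows "convex_on S (\<lambda>x. INF a\<in>A. F a x)"
proof (rule convex_onI)
  fix t :: real and x y
  assume t: "0 < t" "t < 1" and xy: "x \<in> S" "y \<in> S"
  have z: "(1 - t) *\<^sub>R x + t *\<^sub>R y \<in> S"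
    using \<open>convex S\<close> xy t by (simp add: convex_alt)
  show "(INF a\<in>A. F a ((1 - t) *\<^sub>R x + t *\<^sub>R y)) \<le> (1 - t) * (INF a\<in>A. F a x) + t * (INF a\<in>A. F a y)"
  proof (rule field_le_epsilon)
    fix e :: real assume "e > 0"
    obtain a where a: "a \<in> A" "F a x < (INF a\<in>A. F a x) + e"
      using cINF_less_iff[OF \<open>A \<noteq> {}\<close> bdd[OF xy(1)], of "(INF a\<in>A. F a x) + e"] \<open>e > 0\<close> by auto
    obtain b where b: "b \<in> A" "F b y < (INF a\<in>A. F a y) + e"
      using cINF_less_iff[OF \<open>A \<noteq> {}\<close> bdd[OF xy(2)], of "(INF a\<in>A. F a y) + e"] \<open>e > 0\<close> by auto
    obtain c where c: "c \<in> A" "F c ((1 - t) *\<^sub>R x + t *\<^sub>R y) \<le> (1 - t) * F a x + t * F b y"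
      using dir[OF a(1) b(1) xy t] by blast
    have "(INF a\<in>A. F a ((1 - t) *\<^sub>R x + t *\<^sub>R y)) \<le> F c ((1 - t) *\<^sub>R x + t *\<^sub>R y)"
      by (rule cINF_lower[OF bdd[OF z] c(1)])
    also note c(2)
    also have "(1 - t) * F a x + t * F b y
        \<le> (1 - t) * ((INF a\<in>A. F a x) + e) + t * ((INF a\<in>A. F a y) + e)"
      using a b t by (intro add_mono mult_left_mono) auto
    also have "\<dots> = (1 - t) * (INF a\<in>A. F a x) + t * (INF a\<in>A. F a y) + e"
      by (simp add: algebra_simps)
    finally show "(INF a\<in>A. F a ((1 - t) *\<^sub>R x + t *\<^sub>R y))
      \<le> (1 - t) * (INF a\<in>A. F a x) + t * (INF a\<in>A. F a y) + e" .
  qed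
qed fact

lemma convex_on_infdist:
  fixes S :: "'a::real_normed_vector set"
  assumes "convex S"
  shows "convex_on UNIV (\<lambda>x. infdist x S)"
proof (cases "S = {}")
  \<comment> \<open>\<open>infdist\<close> to the empty set has the default value 0, and a constant
    function is convex.\<close>
  case True
  then show ?thesis by (simp add: infdist_def convex_on_def)
next
  case False
  have "convex_on UNIV (\<lambda>x. INF a\<in>S. dist x a)"
  proof (rule convex_on_INF_directed)
    fix a b x y :: 'a and t :: real
    assume "a \<in> S" "b \<in> S" and t: "0 < t" "t < 1"
    then have "(1 - t) *\<^sub>R a + t *\<^sub>R b \<in> S"
      using assms by (simp add: convex_alt)
    moreover have "dist ((1 - t) *\<^sub>R x + t *\<^sub>R y) ((1 - t) *\<^sub>R a + t *\<^sub>R b)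
        \<le> (1 - t) * dist x a + t * dist y b"
    proof -
      have "(1 - t) *\<^sub>R x + t *\<^sub>R y - ((1 - t) *\<^sub>R a + t *\<^sub>R b)
          = (1 - t) *\<^sub>R (x - a) + t *\<^sub>R (y - b)"
        by (simp add: algebra_simps)
      then show ?thesis
        using norm_triangle_ineq[of "(1 - t) *\<^sub>R (x - a)" "t *\<^sub>R (y - b)"] t
        by (simp add: dist_norm)
    qed
    ultimately show "\<exists>c\<in>S. dist ((1 - t) *\<^sub>R x + t *\<^sub>R y) c \<le> (1 - t) * dist x a + t * dist y b"
      by blast
  qed (use False in auto)
  then show ?thesis using False by (simp add: infdist_notempty)
qed

lemma convex_on_midpoint:
  fixes f :: "'a::real_vector \<Rightarrow> real"
  assumes "convex_on UNIV f"
  shows "2 * f ((1/2) *\<^sub>R (x + y)) \<le> f x + f y"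
  using convex_onD[OF assms, of "1/2" x y] by (simp add: scaleR_add_right)

section \<open>Hahn--Banach and separation of convex functions\<close>

text \<open>
  A Hahn--Banach theorem. A convex function \<open>h\<close> with \<open>h 0 = 0\<close> that is minimal below \<open>f\<close> is
  linear, because \<open>\<lambda>x. h (t *\<^sub>R x) / t\<close> for \<open>0 < t \<le> 1\<close> and \<open>\<lambda>x. h (x + a) - h a\<close> are again
  convex, vanish at \<open>0\<close> and lie below \<open>h\<close>.
\<close>

lemma linear_minorant_of_convex:
  fixes f :: "'a::real_vector \<Rightarrow> real"
  assumes f: "convex_on UNIV f" and f0: "f 0 = 0"
  obtains l where "linear l" "\<And>x. l x \<le> f x"
proof -
  define H where "H = {h. convex_on UNIV h \<and> h 0 = 0 \<and> h \<le> f}"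
  \<comment> \<open>A lower bound common to all of \<open>H\<close>, so that pointwise infima over
    chains are finite. It comes from midpoint convexity at \<open>x\<close> and \<open>- x\<close>,
    whose midpoint is 0.\<close>
  have lower: "- f (- x) \<le> h x" if "h \<in> H" for h x
  proof -
    have "0 \<le> h x + h (- x)"
      using convex_on_midpoint[of h x "- x"] that by (simp add: H_def)
    moreover have "h (- x) \<le> f (- x)"
      using that by (simp add: H_def le_fun_def)
    ultimately show ?thesis by simp
  qed
  have "\<exists>m\<in>H. \<forall>a\<in>H. a \<le> m \<longrightarrow> a = m"
  \<comment> \<open>The order is reversed: a maximal element is a pointwise minimal function, and
    chains need lower bounds in \<open>H\<close>.\<close>
  proof (rule predicate_Zorn)
    show "partial_order_on H (relation_of (\<lambda>x y. y \<le> x) H)"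
      by (rule partial_order_on_relation_ofI) auto
  next
    fix C assume C: "C \<in> Chains (relation_of (\<lambda>x y. y \<le> x) H)"
    then have CH: "C \<subseteq> H" and tot: "\<And>h k. h \<in> C \<Longrightarrow> k \<in> C \<Longrightarrow> h \<le> k \<or> k \<le> h"
      by (auto simp: Chains_def relation_of_def)
    show "\<exists>u\<in>H. \<forall>a\<in>C. u \<le> a"
    proof (cases "C = {}")
      case True
      then show ?thesis using f f0 by (auto simp: H_def)
    next
      case False
      define u where "u x = (INF h\<in>C. h x)" for x
      have bdd: "bdd_below ((\<lambda>h. h x) ` C)" for x
        using lower CH by (intro bdd_belowI2[of _ "- f (- x)"]) auto
      have "convex_on UNIV u"
        unfolding u_def
      proof (rule convex_on_INF_directed[OF False convex_UNIV bdd])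
        fix h k x y and t :: real
        assume hk: "h \<in> C" "k \<in> C" and t: "0 < t" "t < 1"
        \<comment> \<open>By totality of the chain, \<open>m\<close> is the smaller of
          \<open>h\<close> and \<open>k\<close>.\<close>
        then obtain m where m: "m \<in> C" "m \<le> h" "m \<le> k"
          using tot by blast
        have "m ((1 - t) *\<^sub>R x + t *\<^sub>R y) \<le> (1 - t) * m x + t * m y"
          using m CH t by (intro convex_onD[of UNIV]) (auto simp: H_def)
        also have "\<dots> \<le> (1 - t) * h x + t * k y"
          using m t by (intro add_mono mult_left_mono) (auto simp: le_fun_def)
        finally show "\<exists>m\<in>C. m ((1 - t) *\<^sub>R x + t *\<^sub>R y) \<le> (1 - t) * h x + t * k y"
          using m by blast
      qed
      moreover have "u 0 = 0"
      proof -
        have "(\<lambda>h. h 0) ` C = {0}"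
          using False CH by (auto simp: H_def)
        then show ?thesis by (simp add: u_def)
      qed
      moreover have le: "u \<le> h" if "h \<in> C" for h
        unfolding u_def le_fun_def using cINF_lower[OF bdd that] by blast
      moreover have "u \<le> f"
        using False CH le by (force simp: H_def intro: order_trans)
      ultimately show ?thesis by (auto simp: H_def)
    qed
  qed
  then obtain l where lH: "l \<in> H" and min: "\<And>k. k \<in> H \<Longrightarrow> k \<le> l \<Longrightarrow> k = l"
    by blast
  have l: "convex_on UNIV l" "l 0 = 0" "l \<le> f"
    using lH by (auto simp: H_def)
  have min': "k x = l x" if "convex_on UNIV k" "k 0 = 0" "\<And>x. k x \<le> l x" for k x
  proof -
    have "k \<le> l" using that by (simp add: le_fun_def)
    then have "k \<in> H" using that l by (auto simp: H_def)
    from min[OF this \<open>k \<le> l\<close>] show ?thesis by simp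
  qed
  have hom1: "l (t *\<^sub>R x) = t * l x" if t: "0 < t" "t \<le> 1" for t x
  proof -
    have "l (t *\<^sub>R x) / t = l x"
    proof (rule min'[where k = "\<lambda>x. l (t *\<^sub>R x) / t"])
      show "convex_on UNIV (\<lambda>x. l (t *\<^sub>R x) / t)"
      proof (rule convex_onI)
        fix s :: real and x y assume s: "0 < s" "s < 1"
        have "l (t *\<^sub>R ((1 - s) *\<^sub>R x + s *\<^sub>R y)) = l ((1 - s) *\<^sub>R (t *\<^sub>R x) + s *\<^sub>R (t *\<^sub>R y))"
          by (simp add: algebra_simps)
        also have "\<dots> \<le> (1 - s) * l (t *\<^sub>R x) + s * l (t *\<^sub>R y)"
          using s by (intro convex_onD[OF l(1)]) auto
        finally show "l (t *\<^sub>R ((1 - s) *\<^sub>R x + s *\<^sub>R y)) / t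
            \<le> (1 - s) * (l (t *\<^sub>R x) / t) + s * (l (t *\<^sub>R y) / t)"
          using t by (simp add: field_simps)
      qed simp
      show "l (t *\<^sub>R x) / t \<le> l x" for x
        using convex_onD[OF l(1), of t 0 x] t l(2) by (simp add: field_simps)
    qed (simp add: l)
    then show ?thesis using t by (simp add: field_simps)
  qed
  have add: "l (x + a) = l x + l a" for x a
  proof -
    have "l (x + a) - l a = l x"
    proof (rule min'[where k = "\<lambda>x. l (x + a) - l a"])
      show "convex_on UNIV (\<lambda>x. l (x + a) - l a)"
      proof (rule convex_onI)
        fix s :: real and x y assume s: "0 < s" "s < 1"
        have "l ((1 - s) *\<^sub>R x + s *\<^sub>R y + a) = l ((1 - s) *\<^sub>R (x + a) + s *\<^sub>R (y + a))"
          by (simp add: algebra_simps)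
        also have "\<dots> \<le> (1 - s) * l (x + a) + s * l (y + a)"
          using s by (intro convex_onD[OF l(1)]) auto
        finally show "l ((1 - s) *\<^sub>R x + s *\<^sub>R y + a) - l a
            \<le> (1 - s) * (l (x + a) - l a) + s * (l (y + a) - l a)"
          by (simp add: algebra_simps)
      qed simp
      show "l (x + a) - l a \<le> l x" for x
        \<comment> \<open>Homogeneity for the factor 1/2 turns midpoint convexity into
          subadditivity, which is why \<open>hom1\<close> precedes additivity.\<close>
        using convex_on_midpoint[OF l(1), of x a] hom1[of "1/2" "x + a"] by simp
    qed (simp add: l)
    then show ?thesis by simp
  qed
  have neg: "l (- x) = - l x" for x
    using add[of x "- x"] l(2) by simp
  have hom2: "l (t *\<^sub>R x) = t * l x" if t: "0 < t" for t x
  proof (cases "t \<le> 1")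
    case False
    then show ?thesis
      using hom1[of "1 / t" "t *\<^sub>R x"] t by (simp add: field_simps)
  qed (use t hom1 in auto)
  have "l (t *\<^sub>R x) = t * l x" for t x
    using hom2[of t x] hom2[of "- t" x] neg[of "t *\<^sub>R x"] l(2)
    by (cases t "0::real" rule: linorder_cases) auto
  then have "linear l"
    by (intro linearI) (auto simp: add)
  then show thesis
    using that l(3) by (auto simp: le_fun_def)
qed

text \<open>The separating functional minorizes the infimal convolution of \<open>f\<close> and \<open>\<lambda>u. g (- u)\<close>.\<close>

lemma convex_sandwich:
  fixes f g :: "'a::real_vector \<Rightarrow> real"
  assumes f: "convex_on UNIV f" "f 0 = 0" and g: "convex_on UNIV g" "g 0 = 0"
    and nonneg: "\<And>x. 0 \<le> f x + g x"
  obtains l where "linear l" "\<And>x. l x \<le> f x" "\<And>x. - l x \<le> g x"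
proof -
  define h where "h v = (INF u. f (v + u) + g u)" for v
  \<comment> \<open>Keeps the infimal convolution finite. The points \<open>v + u\<close> and
    \<open>- v\<close> have midpoint \<open>(1/2) *\<^sub>R u\<close>, as do \<open>u\<close> and 0,
    and there \<open>f + g\<close> is nonnegative.\<close>
  have bound: "- f (- v) \<le> f (v + u) + g u" for u v
  proof -
    have "2 * f ((1/2) *\<^sub>R u) \<le> f (v + u) + f (- v)"
      using convex_on_midpoint[OF f(1), of "v + u" "- v"] by simp
    moreover have "2 * g ((1/2) *\<^sub>R u) \<le> g u"
      using convex_on_midpoint[OF g(1), of u 0] g(2) by simp
    ultimately show ?thesis
      using nonneg[of "(1/2) *\<^sub>R u"] by simp
  qed
  have bdd: "bdd_below (range (\<lambda>u. f (v + u) + g u))" for v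
    using bound by (intro bdd_belowI2[of _ "- f (- v)"]) auto
  have h_le: "h v \<le> f (v + u) + g u" for u v
    unfolding h_def by (rule cINF_lower[OF bdd]) simp
  have "convex_on UNIV h"
    unfolding h_def
  proof (rule convex_on_INF_directed[OF UNIV_not_empty convex_UNIV bdd])
    fix a b x y :: 'a and t :: real
    assume t: "0 < t" "t < 1"
    let ?c = "(1 - t) *\<^sub>R a + t *\<^sub>R b"
    have "f ((1 - t) *\<^sub>R (x + a) + t *\<^sub>R (y + b)) \<le> (1 - t) * f (x + a) + t * f (y + b)"
      using t by (intro convex_onD[OF f(1)]) auto
    moreover have "g ?c \<le> (1 - t) * g a + t * g b"
      using t by (intro convex_onD[OF g(1)]) auto
    moreover have "(1 - t) *\<^sub>R (x + a) + t *\<^sub>R (y + b) = (1 - t) *\<^sub>R x + t *\<^sub>R y + ?c"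
      by (simp add: algebra_simps)
    ultimately have "f ((1 - t) *\<^sub>R x + t *\<^sub>R y + ?c) + g ?c
        \<le> (1 - t) * (f (x + a) + g a) + t * (f (y + b) + g b)"
      by (simp add: algebra_simps)
    then show "\<exists>c\<in>UNIV. f ((1 - t) *\<^sub>R x + t *\<^sub>R y + c) + g c
        \<le> (1 - t) * (f (x + a) + g a) + t * (f (y + b) + g b)"
      by blast
  qed
  moreover have "h 0 = 0"
  proof (rule antisym)
    show "h 0 \<le> 0" using h_le[of 0 0] f g by simp
    show "0 \<le> h 0" unfolding h_def using nonneg by (intro cINF_greatest) auto
  qed
  ultimately obtain l where l: "linear l" "\<And>x. l x \<le> h x"
    using linear_minorant_of_convex by blast
  \<comment> \<open>The choice \<open>u = 0\<close> leaves \<open>f x\<close>, since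
    \<open>g 0 = 0\<close>. At the point \<open>- x\<close> the choice \<open>u = x\<close> cancels
    the argument of \<open>f\<close> and leaves \<open>g x\<close>.\<close>
  show thesis
  proof
    show "l x \<le> f x" for x
      using l(2)[of x] h_le[of x 0] g by simp
    show "- l x \<le> g x" for x
      using l(2)[of "- x"] h_le[of "- x" x] f linear_neg[OF l(1), of x] by simp
  qed fact
qed

section \<open>Splitting a linear functional below a sum of convex functions\<close>

lemma linear_convex_on:
  fixes l :: "'a::real_vector \<Rightarrow> real"
  assumes "linear l"
  shows "convex_on UNIV l"
  by (rule convex_onI) (auto simp: linear_add[OF assms] linear_scale[OF assms])

lemma convex_on_sum_fun:
  fixes f :: "'i \<Rightarrow> 'a::real_vector \<Rightarrow> real"
  assumes "\<And>i. i \<in> I \<Longrightarrow> convex_on S (f i)" "convex S"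
  shows "convex_on S (\<lambda>x. \<Sum>i\<in>I. f i x)"
  using assms(1)
proof (induction I rule: infinite_finite_induct)
  case (insert i I)
  then show ?case by (simp add: convex_on_add)
qed (use assms(2) in \<open>simp_all add: convex_on_def\<close>)

text \<open>The algebraic core of the subdifferential sum rule, by splitting off one summand at a
  time: \<open>convex_sandwich\<close> for \<open>f i\<close> and the remaining sum minus
  \<open>l\<close> gives a part \<open>m\<close> of \<open>l\<close> below \<open>f i\<close>, and
  then \<open>l - m\<close> lies below the remaining sum.\<close>

lemma linear_decomposition_sum_convex:
  fixes f :: "'i \<Rightarrow> 'a::real_vector \<Rightarrow> real"
  assumes "finite I" and "\<And>i. i \<in> I \<Longrightarrow> convex_on UNIV (f i)" and "\<And>i. i \<in> I \<Longrightarrow> f i 0 = 0"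
    and "linear l" and "\<And>x. l x \<le> (\<Sum>i\<in>I. f i x)"
  shows "\<exists>k. (\<forall>i\<in>I. linear (k i) \<and> (\<forall>x. k i x \<le> f i x)) \<and> (\<forall>x. (\<Sum>i\<in>I. k i x) = l x)"
  using assms
proof (induction I arbitrary: l rule: finite_induct)
  case empty
  have "l x = 0" for x
    using empty.prems(4)[of x] empty.prems(4)[of "- x"] linear_neg[OF empty.prems(3), of x] by simp
  then show ?case by simp
next
  case (insert i I)
  let ?g = "\<lambda>x. (\<Sum>j\<in>I. f j x) + - l x"
  have "linear (\<lambda>x. - l x)"
    using insert.prems(3) by (rule linear_compose_neg)
  then have "convex_on UNIV ?g"
    using insert.prems(1)
    by (intro convex_on_add[OF convex_on_sum_fun linear_convex_on]) auto
  moreover have "?g 0 = 0"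
    using insert.prems(2) linear_0[OF insert.prems(3)] by simp
  moreover have "0 \<le> f i x + ?g x" for x
    using insert.prems(4)[of x] insert.hyps by simp
  ultimately obtain m where m: "linear m" "\<And>x. m x \<le> f i x" "\<And>x. - m x \<le> ?g x"
    using convex_sandwich[of "f i" ?g] insert.prems(1,2) by auto
  have "linear (\<lambda>x. l x - m x)"
    using insert.prems(3) m(1) by (rule linear_compose_sub)
  moreover have "l x - m x \<le> (\<Sum>j\<in>I. f j x)" for x
    using m(3)[of x] by simp
  ultimately obtain k where k: "\<forall>j\<in>I. linear (k j) \<and> (\<forall>x. k j x \<le> f j x)"
      "\<forall>x. (\<Sum>j\<in>I. k j x) = l x - m x"
    using insert.IH[of "\<lambda>x. l x - m x"] insert.prems(1,2) by auto
  have "(\<Sum>j\<in>insert i I. (k(i := m)) j x) = l x" for x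
  proof -
    have "(\<Sum>j\<in>I. (k(i := m)) j x) = (\<Sum>j\<in>I. k j x)"
      using insert.hyps by (intro sum.cong) auto
    then show ?thesis
      using insert.hyps k(2) by simp
  qed
  moreover have "\<forall>j\<in>insert i I. linear ((k(i := m)) j) \<and> (\<forall>x. (k(i := m)) j x \<le> f j x)"
    using k(1) m by auto
  ultimately show ?case by blast
qed

text \<open>A one-sided bound suffices, since it can be read at \<open>x\<close> and at
  \<open>- x\<close>. This supplies the continuity that the algebraic decomposition leaves
  open.\<close>

lemma bounded_linear_le_norm:
  fixes l :: "'a::real_normed_vector \<Rightarrow> real"
  assumes "linear l" "\<And>x. l x \<le> C * norm x"
  shows "bounded_linear l"
proof -
  have "\<bar>l x\<bar> \<le> norm x * C" for x
    using assms(2)[of x] assms(2)[of "- x"] linear_neg[OF assms(1), of x] by (simp add: mult.commute)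
  then show ?thesis
    using assms(1) by (intro bounded_linear_intro[of l C])
      (auto simp: linear_add linear_scale)
qed

section \<open>Tangent inequalities for powers\<close>

text \<open>By the mean value theorem the secant slope is the derivative at a point strictly between
  \<open>a\<close> and \<open>b\<close>, and the derivative is strictly increasing. The case
  \<open>b = 0\<close> is computed directly, because the derivative rule \<open>der\<close> covers
  positive arguments only.\<close>

lemma powr_tangent_strict:
  fixes a b p :: real
  assumes "a > 0" "b \<ge> 0" "p > 1" "a \<noteq> b"
  shows "a powr p + p * a powr (p - 1) * (b - a) < b powr p"
proof (cases "b = 0")
  case True
  have "a powr (p - 1) * a = a powr p"
    using assms powr_add[of a "p - 1" 1] by simp
  then have "a powr p + p * a powr (p - 1) * (b - a) = (1 - p) * a powr p"
    using True by (simp add: algebra_simps)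
  also have "\<dots> < 0"
    using assms by (simp add: mult_neg_pos)
  finally show ?thesis using True by simp
next
  case False
  with assms have b: "b > 0" by simp
  have der: "((\<lambda>x. x powr p) has_real_derivative p * x powr (p - 1)) (at x)" if "x > 0" for x
    using that by (auto intro!: derivative_eq_intros)
  show ?thesis
  proof (cases "a < b")
    case True
    then obtain c where c: "a < c" "c < b"
        "b powr p - a powr p = (b - a) * (p * c powr (p - 1))"
      using MVT2[of a b "\<lambda>x. x powr p" "\<lambda>x. p * x powr (p - 1)"] der assms by force
    have "a powr (p - 1) < c powr (p - 1)"
      using c assms by (intro powr_less_mono2) auto
    then have "p * a powr (p - 1) * (b - a) < (b - a) * (p * c powr (p - 1))"
      using True assms by simp
    then show ?thesis using c by simp
  next
    case False
    then have "b < a" using assms by simp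
    then obtain c where c: "b < c" "c < a"
        "a powr p - b powr p = (a - b) * (p * c powr (p - 1))"
      using MVT2[of b a "\<lambda>x. x powr p" "\<lambda>x. p * x powr (p - 1)"] der b by force
    have "c powr (p - 1) < a powr (p - 1)"
      using c b assms by (intro powr_less_mono2) auto
    then have "(a - b) * (p * c powr (p - 1)) < p * a powr (p - 1) * (a - b)"
      using \<open>b < a\<close> assms by simp
    then show ?thesis using c by (simp add: algebra_simps)
  qed
qed

lemma powr_tangent:
  fixes a b p :: real
  assumes "a \<ge> 0" "b \<ge> 0" "p > 1"
  shows "a powr p + p * a powr (p - 1) * (b - a) \<le> b powr p"
  \<comment> \<open>At \<open>a = 0\<close> both powers of \<open>a\<close> are 0, so the claim is
    nonnegativity of \<open>b powr p\<close>; at \<open>a = b\<close> it is an equality.\<close>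
  using powr_tangent_strict[of a b p] assms by (cases "a = 0"; cases "a = b") auto

section \<open>Sufficient and necessary optimality conditions\<close>

lemma Sol_iff:
  assumes "p > 0"
  shows "x \<in> Sol p n \<Omega> \<longleftrightarrow>
    (\<forall>y. (\<Sum>i=1..n. infdist x (\<Omega> i) powr p) \<le> (\<Sum>i=1..n. infdist y (\<Omega> i) powr p))"
proof -
  have "a powr (1 / p) \<le> b powr (1 / p) \<longleftrightarrow> a \<le> b" if "0 \<le> a" "0 \<le> b" for a b
    using powr_mono2[of "1 / p" a b] powr_less_mono2[of "1 / p" b a] assms that by force
  then show ?thesis
    by (simp add: Sol_def dist_objective_def sum_nonneg)
qed

lemma optimality_system_sum_zero:
  assumes "optimality_system p n \<Omega> z \<xi>"
  shows "(\<Sum>i=1..n. infdist z (\<Omega> i) powr (p - 1) * blinfun_apply (\<xi> i) v) = 0"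
proof -
  have "blinfun_apply (\<Sum>i=1..n. (infdist z (\<Omega> i) powr (p - 1)) *\<^sub>R \<xi> i) v = 0"
    using assms by (simp add: optimality_system_def)
  then show ?thesis
    by (simp add: blinfun.sum_left blinfun.scaleR_left)
qed

text \<open>Serves at \<open>xbar\<close> for part (i), and in part (ii) at an arbitrary point of
  the intersection, once the optimality system has been verified there.\<close>

lemma optimality_system_imp_Sol:
  assumes "p > 1" "optimality_system p n \<Omega> z \<xi>"
  shows "z \<in> Sol p n \<Omega>"
proof -
  let ?d = "\<lambda>x i. infdist x (\<Omega> i)"
  have "(\<Sum>i=1..n. ?d z i powr p) \<le> (\<Sum>i=1..n. ?d y i powr p)" for y
  proof -
    have "?d z i powr p + p * (?d z i powr (p - 1) * blinfun_apply (\<xi> i) (y - z)) \<le> ?d y i powr p"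
      if "i \<in> {1..n}" for i
    proof -
      have "blinfun_apply (\<xi> i) (y - z) \<le> ?d y i - ?d z i"
        using assms that by (simp add: optimality_system_def subdiff_def)
      then have "p * (?d z i powr (p - 1) * blinfun_apply (\<xi> i) (y - z))
          \<le> p * (?d z i powr (p - 1) * (?d y i - ?d z i))"
        using assms by (intro mult_left_mono) auto
      moreover have "?d z i powr p + p * (?d z i powr (p - 1) * (?d y i - ?d z i)) \<le> ?d y i powr p"
        using powr_tangent[of "?d z i" "?d y i" p] assms by (simp add: infdist_nonneg mult.assoc)
      ultimately show ?thesis by linarith
    qed
    then have "(\<Sum>i=1..n. ?d z i powr p + p * (?d z i powr (p - 1) * blinfun_apply (\<xi> i) (y - z)))
        \<le> (\<Sum>i=1..n. ?d y i powr p)"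
      by (intro sum_mono) auto
    then show ?thesis
      using optimality_system_sum_zero[OF assms(2), of "y - z"]
      by (simp add: sum.distrib flip: sum_distrib_left)
  qed
  then show ?thesis using assms by (simp add: Sol_iff)
qed

text \<open>Along the segment from \<open>z\<close> to \<open>y\<close>, convexity of the distances
  bounds the sum of powers by \<open>\<phi>\<close>, with equality at \<open>t = 0\<close>. As the
  distances at \<open>z\<close> are positive, \<open>\<phi>\<close> is differentiable at 0 even
  where the distances are not. A negative slope would give a better point on the segment.\<close>

lemma Sol_linearized_minimizer:
  fixes \<Omega> :: "nat \<Rightarrow> 'a::real_normed_vector set"
  assumes p: "p > 1" and conv: "\<And>i. i \<in> {1..n} \<Longrightarrow> convex (\<Omega> i)"
    and pos: "\<And>i. i \<in> {1..n} \<Longrightarrow> infdist z (\<Omega> i) > 0" and z: "z \<in> Sol p n \<Omega>"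
  shows "0 \<le> (\<Sum>i=1..n. infdist z (\<Omega> i) powr (p - 1) * (infdist y (\<Omega> i) - infdist z (\<Omega> i)))"
proof (rule ccontr)
  let ?d = "\<lambda>x i. infdist x (\<Omega> i)"
  define \<phi> where "\<phi> t = (\<Sum>i=1..n. (?d z i + t * (?d y i - ?d z i)) powr p)" for t
  let ?D = "\<Sum>i=1..n. p * ?d z i powr (p - 1) * (?d y i - ?d z i)"
  assume "\<not> ?thesis"
  then have "p * (\<Sum>i=1..n. ?d z i powr (p - 1) * (?d y i - ?d z i)) < 0"
    using p by (simp add: mult_pos_neg)
  then have "?D < 0"
    by (simp add: sum_distrib_left mult.assoc)
  moreover have "(\<phi> has_real_derivative ?D) (at 0)"
    unfolding \<phi>_def
    by (rule DERIV_sum) (use pos in \<open>auto intro!: derivative_eq_intros\<close>)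
  ultimately obtain e where e: "e > 0" "\<And>h. h > 0 \<Longrightarrow> h < e \<Longrightarrow> \<phi> h < \<phi> 0"
    using DERIV_neg_dec_right[of \<phi> ?D 0] by auto
  define t where "t = min (e / 2) (1 / 2)"
  have t: "0 < t" "t < 1" "t < e" using e by (auto simp: t_def)
  have "\<phi> 0 \<le> (\<Sum>i=1..n. ?d ((1 - t) *\<^sub>R z + t *\<^sub>R y) i powr p)"
    using z p by (simp add: Sol_iff \<phi>_def)
  also have "\<dots> \<le> \<phi> t"
    unfolding \<phi>_def
  proof (intro sum_mono powr_mono2)
    fix i assume i: "i \<in> {1..n}"
    have "?d ((1 - t) *\<^sub>R z + t *\<^sub>R y) i \<le> (1 - t) * ?d z i + t * ?d y i"
      using convex_onD[OF convex_on_infdist[OF conv[OF i]]] t by simp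
    then show "?d ((1 - t) *\<^sub>R z + t *\<^sub>R y) i \<le> ?d z i + t * (?d y i - ?d z i)"
      by (simp add: algebra_simps)
  qed (use p in \<open>auto simp: infdist_nonneg\<close>)
  finally show False using e(2)[of t] t by simp
qed

text \<open>By \<open>Sol_linearized_minimizer\<close> the zero functional lies below the sum of the
  weighted distance increments. Its decomposition, divided by the positive weights, gives the
  subgradients.\<close>

lemma Sol_imp_optimality_system:
  fixes \<Omega> :: "nat \<Rightarrow> 'a::real_normed_vector set"
  assumes p: "p > 1" and conv: "\<And>i. i \<in> {1..n} \<Longrightarrow> convex (\<Omega> i)"
    and pos: "\<And>i. i \<in> {1..n} \<Longrightarrow> infdist z (\<Omega> i) > 0" and z: "z \<in> Sol p n \<Omega>"
  shows "\<exists>\<xi>. optimality_system p n \<Omega> z \<xi>"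
proof -
  define w where "w i = infdist z (\<Omega> i) powr (p - 1)" for i
  have w: "w i > 0" if "i \<in> {1..n}" for i
    using pos[OF that] by (simp add: w_def)
  \<comment> \<open>The weighted distance is recentred at \<open>z\<close>, so that
    \<open>f i 0 = 0\<close> as the decomposition requires.\<close>
  define f where "f i v = w i * (infdist (z + v) (\<Omega> i) - infdist z (\<Omega> i))" for i v
  have "convex_on UNIV (f i)" if "i \<in> {1..n}" for i
    unfolding f_def
  proof (intro convex_on_cmul convex_onI)
    fix t :: real and x y assume t: "0 < t" "t < 1"
    have "infdist ((1 - t) *\<^sub>R (z + x) + t *\<^sub>R (z + y)) (\<Omega> i)
        \<le> (1 - t) * infdist (z + x) (\<Omega> i) + t * infdist (z + y) (\<Omega> i)"
      using convex_onD[OF convex_on_infdist[OF conv[OF that]]] t by simp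
    moreover have "(1 - t) *\<^sub>R (z + x) + t *\<^sub>R (z + y) = z + ((1 - t) *\<^sub>R x + t *\<^sub>R y)"
      by (simp add: algebra_simps)
    ultimately show "infdist (z + ((1 - t) *\<^sub>R x + t *\<^sub>R y)) (\<Omega> i) - infdist z (\<Omega> i)
        \<le> (1 - t) * (infdist (z + x) (\<Omega> i) - infdist z (\<Omega> i))
          + t * (infdist (z + y) (\<Omega> i) - infdist z (\<Omega> i))"
      by (simp add: algebra_simps)
  qed (use w[OF that] in auto)
  moreover have f0: "f i 0 = 0" for i
    by (simp add: f_def)
  moreover have "0 \<le> (\<Sum>i=1..n. f i v)" for v
    unfolding f_def w_def using Sol_linearized_minimizer[OF p conv pos z] by blast
  ultimately obtain k where k: "\<And>i. i \<in> {1..n} \<Longrightarrow> linear (k i)"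
      "\<And>i x. i \<in> {1..n} \<Longrightarrow> k i x \<le> f i x" "\<And>x. (\<Sum>i=1..n. k i x) = 0"
    using linear_decomposition_sum_convex[of "{1..n}" f "\<lambda>_. 0"] f0 linear_zero
    by (metis finite_atLeastAtMost)
  define \<xi> where "\<xi> i = (1 / w i) *\<^sub>R Blinfun (k i)" for i
  \<comment> \<open>\<open>Blinfun (k i)\<close> is meaningful only for bounded linear
    \<open>k i\<close>. The bound holds because distance functions are 1-Lipschitz.\<close>
  have bl: "bounded_linear (k i)" if i: "i \<in> {1..n}" for i
  proof (rule bounded_linear_le_norm[OF k(1)[OF i]])
    fix x
    have "infdist (z + x) (\<Omega> i) - infdist z (\<Omega> i) \<le> norm x"
      using infdist_triangle[of "z + x" "\<Omega> i" z] by (simp add: dist_norm)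
    then have "f i x \<le> w i * norm x"
      unfolding f_def using w[OF i] by (intro mult_left_mono) auto
    then show "k i x \<le> w i * norm x"
      using k(2)[OF i, of x] by simp
  qed
  have k_eq: "k i v = w i * blinfun_apply (\<xi> i) v" if "i \<in> {1..n}" for i v
    using w[OF that] bl[OF that]
    by (simp add: \<xi>_def blinfun.scaleR_left bounded_linear_Blinfun_apply)
  have "\<xi> i \<in> subdiff (\<lambda>x. infdist x (\<Omega> i)) z" if i: "i \<in> {1..n}" for i
    unfolding subdiff_def
  proof safe
    fix y
    have "w i * blinfun_apply (\<xi> i) (y - z) \<le> w i * (infdist y (\<Omega> i) - infdist z (\<Omega> i))"
      using k(2)[OF i, of "y - z"] k_eq[OF i, of "y - z"] by (simp add: f_def)
    then show "blinfun_apply (\<xi> i) (y - z) \<le> infdist y (\<Omega> i) - infdist z (\<Omega> i)"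
      using w[OF i] by simp
  qed
  moreover have "(\<Sum>i=1..n. w i *\<^sub>R \<xi> i) = 0"
  proof (rule blinfun_eqI)
    fix v
    have "(\<Sum>i=1..n. w i * blinfun_apply (\<xi> i) v) = (\<Sum>i=1..n. k i v)"
      by (intro sum.cong) (auto simp: k_eq)
    then show "blinfun_apply (\<Sum>i=1..n. w i *\<^sub>R \<xi> i) v = blinfun_apply 0 v"
      using k(3) by (simp add: blinfun.sum_left blinfun.scaleR_left)
  qed
  ultimately have "optimality_system p n \<Omega> z \<xi>"
    by (simp add: optimality_system_def w_def)
  then show ?thesis by blast
qed

section \<open>Description of the solution set\<close>

text \<open>
  At a second minimizer \<open>x\<close> the chain of tangent and subgradient inequalities collapses to
  equalities; strict convexity of \<open>t \<mapsto> t powr p\<close> then fixes every distance.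
\<close>

lemma Sol_distances_unique:
  fixes \<Omega> :: "nat \<Rightarrow> 'a::real_normed_vector set"
  assumes p: "p > 1" and pos: "\<And>i. i \<in> {1..n} \<Longrightarrow> infdist z (\<Omega> i) > 0"
    and sys: "optimality_system p n \<Omega> z \<xi>" and x: "x \<in> Sol p n \<Omega>" and i: "i \<in> {1..n}"
  shows "infdist x (\<Omega> i) = infdist z (\<Omega> i)" and "blinfun_apply (\<xi> i) (x - z) = 0"
proof -
  let ?d = "\<lambda>x i. infdist x (\<Omega> i)"
  let ?w = "\<lambda>i. ?d z i powr (p - 1)"
  let ?r = "\<lambda>i. ?d x i powr p - ?d z i powr p - p * (?w i * (?d x i - ?d z i))"
  let ?s = "\<lambda>i. p * (?w i * (?d x i - ?d z i - blinfun_apply (\<xi> i) (x - z)))"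
  have sub: "blinfun_apply (\<xi> j) (x - z) \<le> ?d x j - ?d z j" if "j \<in> {1..n}" for j
    using sys that by (simp add: optimality_system_def subdiff_def)
  have r: "?r j \<ge> 0" if "j \<in> {1..n}" for j
    using powr_tangent[of "?d z j" "?d x j" p] p by (simp add: infdist_nonneg mult.assoc)
  have s: "?s j \<ge> 0" if "j \<in> {1..n}" for j
    using sub[OF that] p by simp
  have "(\<Sum>j=1..n. ?r j + ?s j) = (\<Sum>j=1..n. ?d x j powr p) - (\<Sum>j=1..n. ?d z j powr p)
      - p * (\<Sum>j=1..n. ?w j * blinfun_apply (\<xi> j) (x - z))"
    by (simp add: sum_subtractf sum.distrib sum_distrib_left algebra_simps)
  \<comment> \<open>The functional terms cancel by the optimality system, so the total slack is the
    difference of the power sums at \<open>x\<close> and \<open>z\<close>, which is at most 0 by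
    minimality of \<open>x\<close>.\<close>
  also have "\<dots> \<le> 0"
    using x p optimality_system_sum_zero[OF sys, of "x - z"] by (simp add: Sol_iff)
  finally have "(\<Sum>j=1..n. ?r j + ?s j) \<le> 0" .
  moreover have "(\<Sum>j=1..n. ?r j + ?s j) \<ge> 0"
    using r s by (intro sum_nonneg add_nonneg_nonneg) auto
  ultimately have "(\<Sum>j=1..n. ?r j + ?s j) = 0" by simp
  then have "\<forall>j\<in>{1..n}. ?r j + ?s j = 0"
    using r s by (subst (asm) sum_nonneg_eq_0_iff) auto
  then have eq: "?r i = 0" "?s i = 0"
    using r[OF i] s[OF i] i by (smt (verit))+
  have "\<not> ?d z i \<noteq> ?d x i"
    using powr_tangent_strict[of "?d z i" "?d x i" p] pos[OF i] p eq(1)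
    by (auto simp: infdist_nonneg mult.assoc)
  then show d: "?d x i = ?d z i" by simp
  show "blinfun_apply (\<xi> i) (x - z) = 0"
    using eq(2) d p pos[OF i] by auto
qed

theorem theorem6p1:
  fixes \<Omega> :: "nat \<Rightarrow> 'a::real_normed_vector set" and n :: nat and p :: real and xbar :: 'a
  assumes "n \<ge> 2" and "p > 1"
    and "\<And>i. i \<in> {1..n} \<Longrightarrow> \<Omega> i \<noteq> {} \<and> closed (\<Omega> i) \<and> convex (\<Omega> i)"
    and "xbar \<notin> (\<Union>i\<in>{1..n}. \<Omega> i)"
  shows "(xbar \<in> Sol p n \<Omega> \<longleftrightarrow> (\<exists>\<xi>. optimality_system p n \<Omega> xbar \<xi>)) \<and>
         (\<forall>\<xi>. optimality_system p n \<Omega> xbar \<xi> \<longrightarrow>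
            Sol p n \<Omega> = (\<Inter>i\<in>{1..n}. D_set p n \<Omega> xbar i (\<xi> i)))"
proof (intro conjI allI impI)
  let ?d = "\<lambda>x i. infdist x (\<Omega> i)"
  let ?F = "\<lambda>x. \<Sum>j=1..n. ?d x j powr p"
  have pos: "?d xbar i > 0" if "i \<in> {1..n}" for i
    using assms(3)[OF that] assms(4) that by (intro infdist_pos_not_in_closed) auto
  show "xbar \<in> Sol p n \<Omega> \<longleftrightarrow> (\<exists>\<xi>. optimality_system p n \<Omega> xbar \<xi>)"
    using Sol_imp_optimality_system[of p n \<Omega> xbar] optimality_system_imp_Sol[of p n \<Omega> xbar]
      assms(2,3) pos by blast
  fix \<xi> assume sys: "optimality_system p n \<Omega> xbar \<xi>"
  show "Sol p n \<Omega> = (\<Inter>i\<in>{1..n}. D_set p n \<Omega> xbar i (\<xi> i))"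
  proof (intro equalityI subsetI)
    fix x assume x: "x \<in> Sol p n \<Omega>"
    have eq: "?d x i = ?d xbar i" "blinfun_apply (\<xi> i) (x - xbar) = 0" if "i \<in> {1..n}" for i
      using Sol_distances_unique[of p n xbar \<Omega> \<xi> x i] assms(2) pos sys x that by auto
    show "x \<in> (\<Inter>i\<in>{1..n}. D_set p n \<Omega> xbar i (\<xi> i))"
    proof
      fix i assume i: "i \<in> {1..n}"
      \<comment> \<open>The subgradient inequality moves from \<open>xbar\<close> to
        \<open>x\<close>, because both the functional and the distance take equal values at the two
        points.\<close>
      have "blinfun_apply (\<xi> i) (y - x) \<le> ?d y i - ?d x i" for y
      proof -
        have "blinfun_apply (\<xi> i) (y - x) = blinfun_apply (\<xi> i) (y - xbar)"
          using eq(2)[OF i] by (simp add: blinfun.diff_right)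
        also have "\<dots> \<le> ?d y i - ?d xbar i"
          using sys i by (simp add: optimality_system_def subdiff_def)
        finally show ?thesis using eq(1)[OF i] by simp
      qed
      moreover have "?F x = ?F xbar"
        using eq(1) by (intro sum.cong) auto
      ultimately show "x \<in> D_set p n \<Omega> xbar i (\<xi> i)"
        using eq(1)[OF i] by (simp add: D_set_def A_set_def E_set_def subdiff_def)
    qed
  next
    fix x assume x: "x \<in> (\<Inter>i\<in>{1..n}. D_set p n \<Omega> xbar i (\<xi> i))"
    have quot: "?d x i powr p / ?F x = ?d xbar i powr p / ?F xbar" if "i \<in> {1..n}" for i
      using x that by (auto simp: D_set_def E_set_def)
    have "1 \<in> {1..n}" using assms(1) by simp
    have "?d xbar i powr p > 0" if "i \<in> {1..n}" for i
      using pos[OF that] by simp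
    then have Fz: "?F xbar > 0"
      using \<open>1 \<in> {1..n}\<close> by (intro sum_pos) auto
    have "?d xbar 1 powr p / ?F xbar > 0"
      using pos[OF \<open>1 \<in> {1..n}\<close>] Fz by simp
    then have "?F x \<noteq> 0"
      using quot[OF \<open>1 \<in> {1..n}\<close>] by auto
    then have Fx: "?F x > 0"
      by (simp add: order_less_le sum_nonneg)
    \<comment> \<open>Equality of the quotients says that the \<open>p\<close>-th powers of all
      distances change by the same factor \<open>?F x / ?F xbar\<close>; \<open>c\<close> is its
      \<open>p\<close>-th root. Since \<open>c\<close> does not depend on \<open>i\<close>, its
      power \<open>c powr (p - 1)\<close> factors out of the optimality sum.\<close>
    define c where "c = (?F x / ?F xbar) powr (1 / p)"
    have "?d x i = c * ?d xbar i" if "i \<in> {1..n}" for i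
    proof -
      have "?d x i powr p = (?F x / ?F xbar) * ?d xbar i powr p"
        using quot[OF that] Fx Fz by (simp add: field_simps)
      then have "(?d x i powr p) powr (1 / p) = ((?F x / ?F xbar) * ?d xbar i powr p) powr (1 / p)"
        by simp
      also have "\<dots> = c * (?d xbar i powr p) powr (1 / p)"
        unfolding c_def using Fx Fz by (subst powr_mult) auto
      finally show ?thesis
        using assms(2) by (simp add: powr_powr infdist_nonneg)
    qed
    then have "(\<Sum>i=1..n. (?d x i powr (p - 1)) *\<^sub>R \<xi> i)
        = (\<Sum>i=1..n. c powr (p - 1) *\<^sub>R ((?d xbar i powr (p - 1)) *\<^sub>R \<xi> i))"
      by (intro sum.cong) (auto simp: powr_mult c_def infdist_nonneg)
    also have "\<dots> = 0"
      unfolding scaleR_sum_right[symmetric] using sys by (simp add: optimality_system_def)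
    finally have "optimality_system p n \<Omega> x \<xi>"
      using x by (auto simp: optimality_system_def D_set_def A_set_def)
    then show "x \<in> Sol p n \<Omega>"
      using assms(2) by (rule optimality_system_imp_Sol[rotated])
  qed
qed

end
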